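(* Let $\mathcal{P}$ be a non-empty finite set of odd primes and let $k\in\mathbb{N}$ be a product of prime powers with primes from $\mathcal{P}$. Let $m$ be a power of $2$. Suppose that for each $p\in\mathcal{P}$ and each $n\geq 1$ the group $(\mathbb{Z}_p)^n$ satisfies Property D. Then there exists $c(k)$ with $1<c(k)<k$, depending only on $k$, such that for every $n\geq 1$ $$ s((\mathbb{Z}_{mk})^n)\leq 2^n(m-1)k+c(k)^n(k-1)+1. $$
   Context: A sequence over a finite abelian group $A$ is a finite unordered list of elements of $A$ with repetitions allowed; its length counts multiplicity, a subsequence is a sub-multiset, a zero-sum sequence is one whose terms sum to $0$, and $T^{j}$ denotes the sequence in which every term of $T$ is repeated $j$ times. The Erdős–Ginzburg–Ziv constant $s(A)$ is the smallest integer $\ell$ such that every sequence over $A$ of length at least $\ell$ has a zero-sum subsequence of length $\exp(A)$ (the exponent of $A$). The group $(\mathbb{Z}_q)^n$ satisfies Property D if every sequence $S$ over it of length $s((\mathbb{Z}_q)^n)-1$ with no zero-sum subsequence of length $q$ has the form $S=T^{q-1}$ for some sequence $T$. *)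

theory Defs
  imports
    Complex_Main
    "HOL-Library.Multiset"
    "HOL-Computational_Algebra.Primes"
    "HOL-Algebra.FiniteProduct"
    "HOL-Algebra.Product_Groups"
begin

text \<open>
  A sequence over a finite abelian group \<open>A\<close> is a multiset of elements of \<open>carrier A\<close>.  The group
  operation is written multiplicatively in the library, so a sum of terms is a product in \<open>A\<close>
  and \<open>0\<close> is \<open>\<one>\<^bsub>A\<^esub>\<close>.
\<close>

definition sequences_over :: "('a, 'b) monoid_scheme \<Rightarrow> 'a multiset set" where
  "sequences_over A = {S. set_mset S \<subseteq> carrier A}"

definition seq_sum :: "('a, 'b) monoid_scheme \<Rightarrow> 'a multiset \<Rightarrow> 'a" where
  "seq_sum A S = finprod A (\<lambda>x. x [^]\<^bsub>A\<^esub> count S x) (set_mset S)"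

definition has_zero_sum_subseq :: "('a, 'b) monoid_scheme \<Rightarrow> nat \<Rightarrow> 'a multiset \<Rightarrow> bool" where
  "has_zero_sum_subseq A l S \<longleftrightarrow> (\<exists>T. T \<subseteq># S \<and> size T = l \<and> seq_sum A T = \<one>\<^bsub>A\<^esub>)"

definition group_exp :: "('a, 'b) monoid_scheme \<Rightarrow> nat" where
  "group_exp A = (LEAST e. e > 0 \<and> (\<forall>x\<in>carrier A. x [^]\<^bsub>A\<^esub> e = \<one>\<^bsub>A\<^esub>))"

text \<open>The Erdos--Ginzburg--Ziv constant.\<close>

definition egz :: "('a, 'b) monoid_scheme \<Rightarrow> nat" where
  "egz A = (LEAST l. \<forall>S\<in>sequences_over A. size S \<ge> l \<longrightarrow> has_zero_sum_subseq A (group_exp A) S)"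

definition Zmod_pow :: "nat \<Rightarrow> nat \<Rightarrow> (nat \<Rightarrow> int) monoid" where
  "Zmod_pow q n = product_group {..<n} (\<lambda>_. integer_mod_group q)"

definition property_D :: "nat \<Rightarrow> nat \<Rightarrow> bool" where
  "property_D q n \<longleftrightarrow>
     (\<forall>S\<in>sequences_over (Zmod_pow q n).
        size S = egz (Zmod_pow q n) - 1 \<and> \<not> has_zero_sum_subseq (Zmod_pow q n) q S \<longrightarrow>
        (\<exists>T\<in>sequences_over (Zmod_pow q n). S = repeat_mset (q - 1) T))"

end

theory Submission
  imports Defs "HOL-Number_Theory.Residues"
begin

text \<open>
  For a subgroup \<open>H\<close> with \<open>exp G = exp H * exp (G/H)\<close> one has
  \<open>s(G) - 1 \<le> (s(H) - 1) * exp (G/H) + (s(G/H) - 1)\<close>, so bounds of the shape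
  \<open>s((Z_q)\<^sup>n) - 1 \<le> C * (q - 1)\<close> multiply along the prime factorisation of \<open>q\<close>. For \<open>q = 2\<close> the
  pigeonhole principle gives \<open>C = 2\<^sup>n\<close>. For an odd prime \<open>p\<close>, Property D says that an extremal
  sequence is \<open>T\<^bsup>p-1\<^esup>\<close>, and \<open>T\<close> is then a set without nontrivial solutions of \<open>x + y = 2 z\<close>.
  By the slice rank method of Croot--Lev--Pach, Ellenberg--Gijswijt and Tao, \<open>|T| \<le> 3 g\<^sup>n\<close> for some
  \<open>g < p\<close>; raising \<open>g\<close> slightly absorbs the factor \<open>3\<close> for large \<open>n\<close>, and the trivial bound
  \<open>|T| < p\<^sup>n\<close> handles small \<open>n\<close>. Then \<open>c(k)\<close> is the largest of these bases over the primes
  dividing \<open>k\<close>.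
\<close>

section \<open>Sets without three-term progressions modulo a prime\<close>

text \<open>
  Linear algebra modulo \<open>p\<close> is done with integer-valued functions and divisibility, since \<open>p\<close> varies
  inside the theorem and cannot be carried by a type.
\<close>

lemma homogeneous_system_mod:
  fixes w :: "'j \<Rightarrow> 'a \<Rightarrow> int"
  assumes "p > 1" "finite X" "finite J" "card J < card X"
  obtains v where "\<And>j. j \<in> J \<Longrightarrow> int p dvd (\<Sum>x\<in>X. v x * w j x)"
    and "\<And>x. x \<notin> X \<Longrightarrow> v x = 0" and "\<exists>x\<in>X. \<not> int p dvd v x"
proof -
  \<comment> \<open>Pigeonhole: \<open>p ^ card X\<close> vectors of residues have at most
    \<open>p ^ card J\<close> tuples of sums. Two vectors collide, and where they differ their
    difference is less than \<open>p\<close> in absolute value, hence nonzero modulo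
    \<open>p\<close>.\<close>
  define V where "V = (\<Pi>\<^sub>E x\<in>X. {0..<int p})"
  define F where "F u = (\<lambda>j\<in>J. (\<Sum>x\<in>X. u x * w j x) mod int p)" for u
  have "F ` V \<subseteq> (\<Pi>\<^sub>E j\<in>J. {0..<int p})"
    using assms(1) by (auto simp: F_def)
  moreover have "finite (\<Pi>\<^sub>E j\<in>J. {0..<int p})"
    using assms(3) by (intro finite_PiE) auto
  ultimately have "card (F ` V) \<le> p ^ card J"
    using card_mono assms(3) by (fastforce simp: card_PiE)
  also have "\<dots> < p ^ card X"
    using assms(1,4) by simp
  also have "\<dots> = card V"
    using assms(2) by (simp add: V_def card_PiE)
  finally have "\<not> inj_on F V"
    using card_image by fastforce
  then obtain a b where ab: "a \<in> V" "b \<in> V" "F a = F b" "a \<noteq> b"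
    by (auto simp: inj_on_def)
  define v where "v x = (if x \<in> X then a x - b x else 0)" for x
  show ?thesis
  proof (rule that)
    fix j assume "j \<in> J"
    then have "(\<Sum>x\<in>X. a x * w j x) mod int p = (\<Sum>x\<in>X. b x * w j x) mod int p"
      using fun_cong[OF ab(3), of j] by (simp add: F_def)
    then have "int p dvd (\<Sum>x\<in>X. a x * w j x) - (\<Sum>x\<in>X. b x * w j x)"
      by (simp add: mod_eq_dvd_iff)
    also have "\<dots> = (\<Sum>x\<in>X. v x * w j x)"
      by (simp add: v_def sum_subtractf left_diff_distrib)
    finally show "int p dvd (\<Sum>x\<in>X. v x * w j x)" .
  next
    obtain x where "a x \<noteq> b x" using ab(4) by auto
    moreover from this have x: "x \<in> X"
      using ab(1,2) by (metis PiE_arb V_def)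
    moreover have "a x \<in> {0..<int p}" "b x \<in> {0..<int p}"
      using ab(1,2) x by (auto simp: V_def)
    ultimately have "\<not> int p dvd v x"
      using dvd_imp_le_int[of "v x" "int p"] by (auto simp: v_def)
    with x show "\<exists>x\<in>X. \<not> int p dvd v x" by blast
  qed (simp add: v_def)
qed

text \<open>A solution of maximal support works: if more than \<open>card J\<close> points lay
  outside its support, a nonzero solution living on those points could be added to it and would
  enlarge the support.\<close>

lemma annihilator_large_support:
  fixes w :: "'j \<Rightarrow> 'a \<Rightarrow> int"
  assumes "p > 1" "finite X" "finite J"
  obtains h where "\<And>j. j \<in> J \<Longrightarrow> int p dvd (\<Sum>x\<in>X. h x * w j x)"
    and "card X \<le> card {x \<in> X. \<not> int p dvd h x} + card J"
proof -
  define good where "good h \<longleftrightarrow> (\<forall>j\<in>J. int p dvd (\<Sum>x\<in>X. h x * w j x))" for h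
  define supp where "supp h = {x \<in> X. \<not> int p dvd h x}" for h :: "'a \<Rightarrow> int"
  have "good (\<lambda>_. 0)" by (simp add: good_def)
  moreover have "\<forall>h. good h \<longrightarrow> card (supp h) < Suc (card X)"
    using assms(2) by (auto simp: supp_def less_Suc_eq_le intro!: card_mono)
  ultimately obtain h where h: "good h" and max: "\<And>h'. good h' \<Longrightarrow> card (supp h') \<le> card (supp h)"
    using ex_has_greatest_nat[of good "\<lambda>_. 0" "\<lambda>h. card (supp h)" "Suc (card X)"] by blast
  have "card X \<le> card (supp h) + card J"
  proof (rule ccontr)
    assume *: "\<not> ?thesis"
    have fin: "finite (supp h)" "supp h \<subseteq> X" using assms(2) by (auto simp: supp_def)
    have "card J < card (X - supp h)"
      using * fin by (simp add: card_Diff_subset)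
    then obtain v where v: "\<And>j. j \<in> J \<Longrightarrow> int p dvd (\<Sum>x\<in>X - supp h. v x * w j x)"
      "\<And>x. x \<notin> X - supp h \<Longrightarrow> v x = 0" "\<exists>x\<in>X - supp h. \<not> int p dvd v x"
      using homogeneous_system_mod[OF assms(1) _ assms(3), of "X - supp h" w] assms(2) by blast
    have "good (\<lambda>x. h x + v x)"
      unfolding good_def
    proof
      fix j assume j: "j \<in> J"
      have "(\<Sum>x\<in>X. v x * w j x) = (\<Sum>x\<in>X - supp h. v x * w j x)"
        using v(2) assms(2) by (intro sum.mono_neutral_right) auto
      then show "int p dvd (\<Sum>x\<in>X. (h x + v x) * w j x)"
        using v(1)[OF j] h j by (simp add: good_def distrib_right sum.distrib)
    qed
    moreover have "supp h \<subset> supp (\<lambda>x. h x + v x)"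
    proof -
      obtain x where x: "x \<in> X" "x \<notin> supp h" "\<not> int p dvd v x" using v(3) by blast
      then have "int p dvd h x" by (simp add: supp_def)
      then have "x \<in> supp (\<lambda>x. h x + v x)"
        using x by (auto simp: supp_def dvd_add_right_iff)
      moreover have "supp h \<subseteq> supp (\<lambda>x. h x + v x)"
        using v(2) by (auto simp: supp_def)
      ultimately show ?thesis using x(2) by blast
    qed
    moreover have "finite (supp (\<lambda>x. h x + v x))"
      using assms(2) by (simp add: supp_def)
    ultimately show False using max psubset_card_mono by (metis leD)
  qed
  with h that show ?thesis by (auto simp: good_def supp_def)
qed

text \<open>
  Contracting the diagonal tensor against \<open>h\<close> in the third variable leaves a diagonal matrix of rank
  at least \<open>card T - card I\<close>, which the remaining slices bound by \<open>2 * card I\<close>.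
\<close>

lemma slice_rank_diagonal_mod:
  fixes u :: "'i \<Rightarrow> 'a \<Rightarrow> int" and K :: "'f \<Rightarrow> int" and f1 f2 f3 :: "'f \<Rightarrow> 'i"
  assumes p: "prime p" and fin: "finite T" "finite I" "finite \<Phi>"
    and low: "\<And>\<phi>. \<phi> \<in> \<Phi> \<Longrightarrow> f1 \<phi> \<in> I \<or> f2 \<phi> \<in> I \<or> f3 \<phi> \<in> I"
    and F: "\<And>x y z. F x y z = (\<Sum>\<phi>\<in>\<Phi>. K \<phi> * u (f1 \<phi>) x * u (f2 \<phi>) y * u (f3 \<phi>) z)"
    and off: "\<And>x y z. x \<in> T \<Longrightarrow> y \<in> T \<Longrightarrow> z \<in> T \<Longrightarrow> \<not> (x = y \<and> y = z) \<Longrightarrow> int p dvd F x y z"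
    and diag: "\<And>x. x \<in> T \<Longrightarrow> \<not> int p dvd F x x x"
  shows "card T \<le> 3 * card I"
proof (rule ccontr)
  assume contr: "\<not> ?thesis"
  have p1: "p > 1" using p prime_gt_1_nat by blast
  have pi: "prime (int p)" using p by simp
  obtain h where h: "\<And>i. i \<in> I \<Longrightarrow> int p dvd (\<Sum>z\<in>T. h z * u i z)"
    and supp: "card T \<le> card {x \<in> T. \<not> int p dvd h x} + card I"
    using annihilator_large_support[OF p1 fin(1,2), of u] by blast
  define S where "S = {x \<in> T. \<not> int p dvd h x}"
  define H where "H i = (\<Sum>z\<in>T. h z * u i z)" for i
  \<comment> \<open>After contracting \<open>F\<close> with \<open>h\<close> in the third variable,
    \<open>W i\<close> collects everything that multiplies \<open>u i y\<close>.\<close>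
  define W where "W i x = (\<Sum>\<phi> | \<phi> \<in> \<Phi> \<and> f2 \<phi> = i. K \<phi> * u (f1 \<phi>) x * H (f3 \<phi>))" for i x
  have S: "finite S" "S \<subseteq> T" using fin by (auto simp: S_def)
  \<comment> \<open>The left copy of \<open>I\<close> imposes orthogonality of \<open>v\<close> to
    the low slices in \<open>x\<close>, the right copy to the functions \<open>W i\<close>. These
    \<open>2 * card I\<close> conditions are fewer than \<open>card S\<close>, which is at least
    \<open>card T - card I\<close>.\<close>
  have "finite (I <+> I)" "card (I <+> I) < card S"
    using contr supp fin by (simp_all add: card_Plus S_def)
  then obtain v where v: "\<And>j. j \<in> I <+> I \<Longrightarrow> int p dvd (\<Sum>x\<in>S. v x * case_sum u W j x)"
    and v0: "\<And>x. x \<notin> S \<Longrightarrow> v x = 0" and v1: "\<exists>x\<in>S. \<not> int p dvd v x"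
    using homogeneous_system_mod[OF p1 S(1), of "I <+> I" "case_sum u W"] by blast
  have vT: "(\<Sum>x\<in>T. v x * g x) = (\<Sum>x\<in>S. v x * g x)" for g
    using S v0 fin by (intro sum.mono_neutral_right) auto
  have vu: "int p dvd (\<Sum>x\<in>T. v x * u i x)" and vW: "int p dvd (\<Sum>x\<in>T. v x * W i x)"
    if "i \<in> I" for i
    using v[of "Inl i"] v[of "Inr i"] that by (auto simp: vT)
  define U where "U i = (\<Sum>x\<in>T. v x * u i x)" for i
  have "int p dvd v y * h y" if y: "y \<in> T" for y
  proof -
    \<comment> \<open>For fixed \<open>y\<close>, this contraction is evaluated twice modulo
      \<open>p\<close>: from the slice decomposition it vanishes, and from the diagonal shape of
      \<open>F\<close> it is \<open>v y * h y * F y y y\<close>.\<close>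
    define tot where "tot = (\<Sum>x\<in>T. \<Sum>z\<in>T. v x * h z * F x y z)"
    have "tot = (\<Sum>x\<in>T. \<Sum>z\<in>T. \<Sum>\<phi>\<in>\<Phi>. K \<phi> * (v x * u (f1 \<phi>) x) * u (f2 \<phi>) y * (h z * u (f3 \<phi>) z))"
      unfolding tot_def F by (simp add: sum_distrib_left mult_ac)
    also have "\<dots> = (\<Sum>\<phi>\<in>\<Phi>. \<Sum>x\<in>T. \<Sum>z\<in>T. K \<phi> * (v x * u (f1 \<phi>) x) * u (f2 \<phi>) y * (h z * u (f3 \<phi>) z))"
      by (simp only: sum.swap[of _ \<Phi> T])
    also have "\<dots> = (\<Sum>\<phi>\<in>\<Phi>. K \<phi> * U (f1 \<phi>) * u (f2 \<phi>) y * H (f3 \<phi>))"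
      unfolding U_def H_def by (simp add: sum_distrib_left sum_distrib_right mult_ac)
    also have "\<dots> = (\<Sum>\<phi> | \<phi> \<in> \<Phi> \<and> f2 \<phi> \<in> I. K \<phi> * U (f1 \<phi>) * u (f2 \<phi>) y * H (f3 \<phi>)) +
        (\<Sum>\<phi> | \<phi> \<in> \<Phi> \<and> f2 \<phi> \<notin> I. K \<phi> * U (f1 \<phi>) * u (f2 \<phi>) y * H (f3 \<phi>))"
      using fin by (subst sum.union_disjoint[symmetric]) (auto intro: sum.cong)
    also have "(\<Sum>\<phi> | \<phi> \<in> \<Phi> \<and> f2 \<phi> \<in> I. K \<phi> * U (f1 \<phi>) * u (f2 \<phi>) y * H (f3 \<phi>)) =
        (\<Sum>i\<in>I. \<Sum>\<phi> | \<phi> \<in> {\<phi> \<in> \<Phi>. f2 \<phi> \<in> I} \<and> f2 \<phi> = i. K \<phi> * U (f1 \<phi>) * u (f2 \<phi>) y * H (f3 \<phi>))"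
      using fin by (intro sum.group[symmetric]) auto
    also have "\<dots> = (\<Sum>i\<in>I. u i y * (\<Sum>x\<in>T. v x * W i x))"
    proof (intro sum.cong refl)
      fix i assume i: "i \<in> I"
      have "(\<Sum>x\<in>T. v x * W i x) = (\<Sum>x\<in>T. \<Sum>\<phi> | \<phi> \<in> \<Phi> \<and> f2 \<phi> = i. K \<phi> * (v x * u (f1 \<phi>) x) * H (f3 \<phi>))"
        unfolding W_def by (simp add: sum_distrib_left mult_ac)
      also have "\<dots> = (\<Sum>\<phi> | \<phi> \<in> \<Phi> \<and> f2 \<phi> = i. K \<phi> * U (f1 \<phi>) * H (f3 \<phi>))"
        unfolding U_def by (subst sum.swap) (simp add: sum_distrib_left sum_distrib_right mult_ac)
      finally have "u i y * (\<Sum>x\<in>T. v x * W i x) =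
          (\<Sum>\<phi> | \<phi> \<in> \<Phi> \<and> f2 \<phi> = i. K \<phi> * U (f1 \<phi>) * u i y * H (f3 \<phi>))"
        by (simp add: sum_distrib_left mult_ac)
      then show "(\<Sum>\<phi> | \<phi> \<in> {\<phi> \<in> \<Phi>. f2 \<phi> \<in> I} \<and> f2 \<phi> = i. K \<phi> * U (f1 \<phi>) * u (f2 \<phi>) y * H (f3 \<phi>)) =
          u i y * (\<Sum>x\<in>T. v x * W i x)"
        using i by (auto intro!: sum.cong)
    qed
    finally have tot: "tot = (\<Sum>i\<in>I. u i y * (\<Sum>x\<in>T. v x * W i x)) +
        (\<Sum>\<phi> | \<phi> \<in> \<Phi> \<and> f2 \<phi> \<notin> I. K \<phi> * U (f1 \<phi>) * u (f2 \<phi>) y * H (f3 \<phi>))" .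
    \<comment> \<open>A term whose \<open>y\<close>-factor is not low has a low factor in
      \<open>x\<close> or in \<open>z\<close>, and that one is annihilated by \<open>v\<close> or by
      \<open>h\<close>.\<close>
    have "int p dvd K \<phi> * U (f1 \<phi>) * u (f2 \<phi>) y * H (f3 \<phi>)" if "\<phi> \<in> \<Phi>" "f2 \<phi> \<notin> I" for \<phi>
      using low[OF that(1)] that(2) vu[folded U_def] h[folded H_def] by auto
    then have tot0: "int p dvd tot"
      unfolding tot using vW by (intro dvd_add dvd_sum) auto
    have "int p dvd tot - v y * h y * F y y y"
    proof -
      have "tot = v y * h y * F y y y + (\<Sum>(x,z)\<in>T \<times> T - {(y,y)}. v x * h z * F x y z)"
        unfolding tot_def sum.cartesian_product
        using fin y by (subst sum.remove[of _ "(y,y)"]) auto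
      moreover have "int p dvd (\<Sum>(x,z)\<in>T \<times> T - {(y,y)}. v x * h z * F x y z)"
        using off[OF _ y] by (intro dvd_sum) (auto intro!: dvd_mult)
      ultimately show ?thesis by simp
    qed
    then have "int p dvd v y * h y * F y y y"
      using tot0 by (metis dvd_diff_commute dvd_diff_right_iff)
    then show ?thesis using diag[OF y] pi by (simp add: prime_dvd_mult_iff)
  qed
  \<comment> \<open>Some point of \<open>S\<close> has \<open>v\<close> nonzero modulo
    \<open>p\<close>, and \<open>h\<close> is nonzero modulo \<open>p\<close> on all of
    \<open>S\<close>.\<close>
  then show False
    using v1 pi by (auto simp: S_def prime_dvd_mult_iff)
qed

section \<open>The indicator polynomial of \<open>x + y = 2 z\<close>\<close>

lemma fermat_little_int:
  fixes a :: int
  assumes "prime p" "\<not> int p dvd a"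
  shows "int p dvd 1 - a ^ (p - 1)"
proof -
  define b where "b = nat (a mod int p)"
  have p0: "int p > 0" using assms(1) prime_gt_0_nat by simp
  then have b: "int b = a mod int p" by (simp add: b_def)
  then have "\<not> p dvd b"
    using assms(2) by (metis dvd_mod_iff dvd_refl int_dvd_int_iff)
  then have "[b ^ (p - 1) = 1] (mod p)" using fermat_theorem assms(1) by blast
  then have "[int b ^ (p - 1) = 1] (mod int p)"
    by (metis cong_int_iff of_nat_1 of_nat_power)
  then have "[a ^ (p - 1) = 1] (mod int p)"
    unfolding b by (simp add: cong_def power_mod)
  then show ?thesis by (metis cong_iff_dvd_diff cong_sym)
qed

text \<open>With \<open>d = p - 1\<close> the left side is, modulo \<open>p\<close>, the indicator
  of \<open>x + y = 2 z\<close>. What the slice rank argument takes from the expansion is the degree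
  bound on the exponents.\<close>

lemma one_minus_power_trinomial:
  fixes d :: nat
  assumes "d > 0"
  obtains E :: "(nat \<times> nat \<times> nat) set" and K :: "nat \<times> nat \<times> nat \<Rightarrow> int"
  where "finite E" "\<And>a b c. (a, b, c) \<in> E \<Longrightarrow> a + b + c \<le> d"
    and "\<And>x y z :: int. 1 - (x + y - 2 * z) ^ d =
           (\<Sum>e\<in>E. K e * x ^ fst e * y ^ fst (snd e) * z ^ snd (snd e))"
proof -
  define D where "D = Sigma {..d} (\<lambda>a. {..d - a})"
  define g where "g = (\<lambda>(a, b). (a, b, d - a - b))"
  define K :: "nat \<times> nat \<times> nat \<Rightarrow> int" where
    "K = (\<lambda>(a, b, c). if (a, b, c) = (0, 0, 0) then 1
            else - (int (d choose a) * int (d - a choose b) * (- 2) ^ c))"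
  show ?thesis
  proof (rule that[of "insert (0, 0, 0) (g ` D)" K])
    show "finite (insert (0, 0, 0) (g ` D))" by (simp add: D_def)
    show "a + b + c \<le> d" if "(a, b, c) \<in> insert (0, 0, 0) (g ` D)" for a b c
      using that by (auto simp: g_def D_def)
    fix x y z :: int
    have inj: "inj_on g D" by (auto simp: g_def inj_on_def)
    have notin: "(0, 0, 0) \<notin> g ` D" using assms by (auto simp: g_def)
    define r :: int where "r = - 2"
    have "(x + y - 2 * z) ^ d = (x + (y + r * z)) ^ d" by (simp add: r_def algebra_simps)
    also have "\<dots> = (\<Sum>a\<le>d. of_nat (d choose a) * x ^ a * (y + r * z) ^ (d - a))"
      by (rule binomial_ring)
    also have "\<dots> = (\<Sum>a\<le>d. \<Sum>b\<le>d - a. int (d choose a) * int (d - a choose b) * r ^ (d - a - b)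
        * x ^ a * y ^ b * z ^ (d - a - b))"
      by (intro sum.cong refl, subst binomial_ring)
         (simp add: sum_distrib_left power_mult_distrib mult_ac)
    also have "\<dots> = (\<Sum>(a,b)\<in>D. int (d choose a) * int (d - a choose b) * r ^ (d - a - b)
        * x ^ a * y ^ b * z ^ (d - a - b))"
      unfolding D_def by (intro sum.Sigma) auto
    also have "\<dots> = (\<Sum>ab\<in>D. - (K (g ab) * x ^ fst (g ab) * y ^ fst (snd (g ab)) * z ^ snd (snd (g ab))))"
      using assms by (intro sum.cong) (auto simp: K_def g_def r_def)
    also have "\<dots> = - (\<Sum>e\<in>g ` D. K e * x ^ fst e * y ^ fst (snd e) * z ^ snd (snd e))"
      using inj by (simp add: sum.reindex sum_negf)
    finally show "1 - (x + y - 2 * z) ^ d =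
        (\<Sum>e\<in>insert (0, 0, 0) (g ` D). K e * x ^ fst e * y ^ fst (snd e) * z ^ snd (snd e))"
      using notin by (simp add: D_def) (simp add: K_def)
  qed
qed

text \<open>Exponents of reduced monomials of degree at most \<open>(p - 1) * n / 3\<close>. Three
  exponent vectors of joint degree at most \<open>(p - 1) * n\<close> always include one of
  these.\<close>

definition low_exponents :: "nat \<Rightarrow> nat \<Rightarrow> (nat \<Rightarrow> nat) set" where
  "low_exponents p n = {\<alpha> \<in> {..<n} \<rightarrow>\<^sub>E {..<p}. 3 * (\<Sum>i<n. \<alpha> i) \<le> (p - 1) * n}"

definition AP3_free :: "nat \<Rightarrow> nat \<Rightarrow> (nat \<Rightarrow> int) set \<Rightarrow> bool" where
  "AP3_free p n T \<longleftrightarrow>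
     (\<forall>x\<in>T. \<forall>y\<in>T. \<forall>z\<in>T. (\<forall>i<n. int p dvd x i + y i - 2 * z i) \<longrightarrow> x = y \<and> y = z)"

text \<open>By Fermat, \<open>F\<close> is modulo \<open>p\<close> the indicator of
  \<open>x + y = 2 z\<close>, so it is diagonal on a progression-free set. Its degree is at most
  \<open>(p - 1) * n\<close>, so each monomial has a low factor in \<open>x\<close>,
  \<open>y\<close> or \<open>z\<close>, which bounds its slice rank.\<close>

lemma AP3_free_card_le_low_exponents:
  assumes p: "prime p" and T: "finite T" "AP3_free p n T"
  shows "card T \<le> 3 * card (low_exponents p n)"
proof -
  have p1: "p > 1" using p prime_gt_1_nat by blast
  then have "p - 1 > 0" by simp
  then obtain E K where E: "finite E" "\<And>a b c. (a, b, c) \<in> E \<Longrightarrow> a + b + c \<le> p - 1"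
    and K: "\<And>x y z :: int. 1 - (x + y - 2 * z) ^ (p - 1) =
           (\<Sum>e\<in>E. K e * x ^ fst e * y ^ fst (snd e) * z ^ snd (snd e))"
    by (rule one_minus_power_trinomial) blast
  \<comment> \<open>Expanding the product over coordinates picks one trinomial term per coordinate;
    \<open>\<phi>\<close> records the choice, and \<open>f1\<close>, \<open>f2\<close>,
    \<open>f3\<close> read off the exponents of \<open>x\<close>, \<open>y\<close>,
    \<open>z\<close>.\<close>
  define \<Phi> where "\<Phi> = (\<Pi>\<^sub>E i\<in>{..<n}. E)"
  define u :: "(nat \<Rightarrow> nat) \<Rightarrow> (nat \<Rightarrow> int) \<Rightarrow> int" where "u \<alpha> x = (\<Prod>i<n. x i ^ \<alpha> i)" for \<alpha> x
  define f1 f2 f3 where "f1 \<phi> = (\<lambda>i\<in>{..<n}. fst (\<phi> i))" and "f2 \<phi> = (\<lambda>i\<in>{..<n}. fst (snd (\<phi> i)))"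
    and "f3 \<phi> = (\<lambda>i\<in>{..<n}. snd (snd (\<phi> i)))" for \<phi> :: "nat \<Rightarrow> nat \<times> nat \<times> nat"
  define F where "F x y z = (\<Prod>i<n. 1 - (x i + y i - 2 * z i) ^ (p - 1))" for x y z :: "nat \<Rightarrow> int"
  have fin: "finite (low_exponents p n)" "finite \<Phi>"
    using E(1) by (auto simp: low_exponents_def \<Phi>_def intro!: finite_PiE)
  show ?thesis
  proof (rule slice_rank_diagonal_mod[OF p T(1) fin, of f1 f2 f3 F "\<lambda>\<phi>. \<Prod>i<n. K (\<phi> i)" u])
    fix \<phi> assume \<phi>: "\<phi> \<in> \<Phi>"
    have sum_le: "fst (\<phi> i) + fst (snd (\<phi> i)) + snd (snd (\<phi> i)) \<le> p - 1" if "i < n" for i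
    proof -
      have "\<phi> i \<in> E" using \<phi> that by (auto simp: \<Phi>_def)
      then show ?thesis using E(2) by (metis prod.collapse)
    qed
    then have "(\<Sum>i<n. fst (\<phi> i) + fst (snd (\<phi> i)) + snd (snd (\<phi> i))) \<le> (\<Sum>i<n. p - 1)"
      by (intro sum_mono) auto
    then have "(\<Sum>i<n. fst (\<phi> i)) + (\<Sum>i<n. fst (snd (\<phi> i))) + (\<Sum>i<n. snd (snd (\<phi> i))) \<le> (p - 1) * n"
      by (simp add: sum.distrib mult.commute)
    then have "3 * (\<Sum>i<n. fst (\<phi> i)) \<le> (p - 1) * n \<or> 3 * (\<Sum>i<n. fst (snd (\<phi> i))) \<le> (p - 1) * n
      \<or> 3 * (\<Sum>i<n. snd (snd (\<phi> i))) \<le> (p - 1) * n"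
      by linarith
    moreover have "f1 \<phi> \<in> {..<n} \<rightarrow>\<^sub>E {..<p}" "f2 \<phi> \<in> {..<n} \<rightarrow>\<^sub>E {..<p}" "f3 \<phi> \<in> {..<n} \<rightarrow>\<^sub>E {..<p}"
    proof -
      have "fst (\<phi> i) < p" "fst (snd (\<phi> i)) < p" "snd (snd (\<phi> i)) < p" if "i < n" for i
        using sum_le[OF that] p1 by linarith+
      then show "f1 \<phi> \<in> {..<n} \<rightarrow>\<^sub>E {..<p}" "f2 \<phi> \<in> {..<n} \<rightarrow>\<^sub>E {..<p}" "f3 \<phi> \<in> {..<n} \<rightarrow>\<^sub>E {..<p}"
        by (auto simp: f1_def f2_def f3_def)
    qed
    ultimately show "f1 \<phi> \<in> low_exponents p n \<or> f2 \<phi> \<in> low_exponents p n \<or> f3 \<phi> \<in> low_exponents p n"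
      by (auto simp: low_exponents_def f1_def f2_def f3_def)
  next
    fix x y z :: "nat \<Rightarrow> int"
    have "F x y z = (\<Sum>\<phi>\<in>\<Phi>. \<Prod>i<n. K (\<phi> i) * x i ^ fst (\<phi> i) * y i ^ fst (snd (\<phi> i)) * z i ^ snd (snd (\<phi> i)))"
      unfolding F_def K \<Phi>_def using E(1) by (intro prod_sum_PiE) auto
    then show "F x y z = (\<Sum>\<phi>\<in>\<Phi>. (\<Prod>i<n. K (\<phi> i)) * u (f1 \<phi>) x * u (f2 \<phi>) y * u (f3 \<phi>) z)"
      by (simp add: prod.distrib u_def f1_def f2_def f3_def)
  next
    fix x y z assume "x \<in> T" "y \<in> T" "z \<in> T" "\<not> (x = y \<and> y = z)"
    then obtain i where i: "i < n" "\<not> int p dvd x i + y i - 2 * z i"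
      using T(2) unfolding AP3_free_def by blast
    then have "int p dvd 1 - (x i + y i - 2 * z i) ^ (p - 1)"
      using fermat_little_int p by blast
    then show "int p dvd F x y z"
      unfolding F_def using i(1) by (intro dvd_prodI[THEN dvd_trans[rotated]]) auto
  next
    fix x assume "x \<in> T"
    have "F x x x = 1" using p1 by (simp add: F_def power_0_left)
    then show "\<not> int p dvd F x x x" using p1 by simp
  qed
qed

section \<open>Counting exponent vectors of low degree\<close>

text \<open>Exponential moment bound: since \<open>t < 1\<close>, every low vector has weight
  \<open>t ^ (3 * degree)\<close> at least \<open>t ^ ((p - 1) * n)\<close>, and the total weight of
  all vectors factors over the coordinates.\<close>

lemma card_low_exponents_le:
  fixes t :: real
  assumes "0 < t" "t < 1"
  shows "real (card (low_exponents p n)) \<le> ((\<Sum>j<p. t ^ (3 * j)) / t ^ (p - 1)) ^ n"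
proof -
  have "real (card (low_exponents p n)) * t ^ ((p - 1) * n) =
      (\<Sum>\<alpha>\<in>low_exponents p n. t ^ ((p - 1) * n))" by simp
  also have "\<dots> \<le> (\<Sum>\<alpha>\<in>low_exponents p n. t ^ (3 * (\<Sum>i<n. \<alpha> i)))"
    using assms by (intro sum_mono power_decreasing) (auto simp: low_exponents_def)
  also have "\<dots> \<le> (\<Sum>\<alpha>\<in>{..<n} \<rightarrow>\<^sub>E {..<p}. t ^ (3 * (\<Sum>i<n. \<alpha> i)))"
    using assms by (intro sum_mono2 finite_PiE) (auto simp: low_exponents_def)
  also have "\<dots> = (\<Sum>\<alpha>\<in>{..<n} \<rightarrow>\<^sub>E {..<p}. \<Prod>i<n. t ^ (3 * \<alpha> i))"
    by (simp add: power_sum sum_distrib_left)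
  also have "\<dots> = (\<Prod>i<n. \<Sum>j<p. t ^ (3 * j))"
    by (rule prod_sum_PiE[symmetric]) auto
  finally show ?thesis
    using assms by (simp add: power_divide pos_le_divide_eq flip: power_mult)
qed

text \<open>The quotient equals \<open>p\<close> at \<open>t = 1\<close> and has derivative
  \<open>p * (p - 1) / 2 > 0\<close> there, so it drops below \<open>p\<close> just to the left of
  1. The sign reflects that the average exponent \<open>(p - 1) / 2\<close> exceeds
  \<open>(p - 1) / 3\<close>.\<close>

lemma tilted_mean_lt:
  assumes "p > 1"
  obtains t :: real where "0 < t" "t < 1" "(\<Sum>j<p. t ^ (3 * j)) / t ^ (p - 1) < real p"
proof -
  define g where "g t = (\<Sum>j<p. t ^ (3 * j)) / t ^ (p - 1)" for t :: real
  have "2 * (\<Sum>j<p. real j) = real p * (real p - 1)"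
    by (induction p) (auto simp: algebra_simps)
  then have sum3: "(\<Sum>j<p. 3 * real j) - real p * (real p - 1) = real p * (real p - 1) / 2"
    by (simp flip: sum_distrib_left)
  have "(g has_real_derivative ((\<Sum>j<p. 3 * real j) - real p * (real p - 1))) (at 1)"
    unfolding g_def using assms
    by (auto intro!: derivative_eq_intros simp: of_nat_diff)
  moreover have "(\<Sum>j<p. 3 * real j) - real p * (real p - 1) > 0"
    unfolding sum3 using assms by simp
  ultimately obtain d where d: "d > 0" "\<And>h. h > 0 \<Longrightarrow> h < d \<Longrightarrow> g (1 - h) < g 1"
    using DERIV_pos_inc_left by blast
  define h where "h = min (d / 2) (1 / 2)"
  have "h > 0" "h < d" "h < 1" using d(1) by (auto simp: h_def)
  then show ?thesis
    using that[of "1 - h"] d(2)[of h] by (simp add: g_def)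
qed

text \<open>The full cube contains the progression formed by the constant vectors 0, 1, 2, so a
  progression-free set misses a point.\<close>

lemma AP3_free_card_less:
  assumes p: "prime p" "odd p" and n: "n \<ge> 1"
    and T: "T \<subseteq> ({..<n} \<rightarrow>\<^sub>E {0..<int p})" "AP3_free p n T"
  shows "card T < p ^ n"
proof -
  have p3: "p \<ge> 3" using p prime_ge_2_nat[of p] by (cases "p = 2") auto
  let ?c = "\<lambda>a::int. \<lambda>i\<in>{..<n}. a"
  have "T \<noteq> ({..<n} \<rightarrow>\<^sub>E {0..<int p})"
  proof
    assume "T = ({..<n} \<rightarrow>\<^sub>E {0..<int p})"
    then have "?c 0 \<in> T" "?c 1 \<in> T" "?c 2 \<in> T"
      using p3 by auto
    then have "?c 0 = ?c 2"
      using T(2)[unfolded AP3_free_def, rule_format, of "?c 0" "?c 2" "?c 1"] by auto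
    then show False using n by (auto dest: fun_cong[of _ _ 0])
  qed
  then have "card T < card ({..<n} \<rightarrow>\<^sub>E {0..<int p})"
    using T(1) by (intro psubset_card_mono finite_PiE) auto
  then show ?thesis by (simp add: card_PiE)
qed

theorem AP3_free_exponential_bound:
  assumes p: "prime p" "odd p"
  obtains c :: real where "1 < c" "c < real p"
    and "\<And>n T. n \<ge> 1 \<Longrightarrow> T \<subseteq> ({..<n} \<rightarrow>\<^sub>E {0..<int p}) \<Longrightarrow> AP3_free p n T \<Longrightarrow> real (card T) \<le> c ^ n"
proof -
  have p1: "p > 1" using p prime_gt_1_nat by blast
  obtain t :: real where t: "0 < t" "t < 1" "(\<Sum>j<p. t ^ (3 * j)) / t ^ (p - 1) < real p"
    using tilted_mean_lt p1 by blast
  define g where "g = (\<Sum>j<p. t ^ (3 * j)) / t ^ (p - 1)"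
  define g' where "g' = (g + real p) / 2"
  have g: "g > 0" unfolding g_def using t p1 by (intro divide_pos_pos sum_pos) auto
  have g': "g < g'" "g' < real p" using t(3)[folded g_def] by (auto simp: g'_def)
  \<comment> \<open>From dimension \<open>N\<close> on, passing from base \<open>g\<close> to
    \<open>g'\<close> pays for the factor 3.\<close>
  obtain N where N: "3 < (g' / g) ^ N"
    using real_arch_pow[of "g' / g" 3] g g' by auto
  have big: "3 * g ^ n \<le> g' ^ n" if "n \<ge> N" for n
  proof -
    have "1 \<le> g' / g" using g g' by simp
    then have "3 \<le> (g' / g) ^ n"
      using N power_increasing[OF that, of "g' / g"] by linarith
    then show ?thesis using g by (simp add: power_divide field_simps)
  qed
  \<comment> \<open>Only finitely many dimensions lie below \<open>N\<close>, so one
    \<open>c\<close> close enough to \<open>p\<close> serves them all. As \<open>card T\<close> is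
    an integer below \<open>p ^ n\<close>, the bound \<open>p ^ n - 1\<close> suffices.\<close>
  have "\<forall>\<^sub>F c in at_left (real p). c ^ n > real p ^ n - 1" for n
  proof -
    have "((\<lambda>c. c ^ n) \<longlongrightarrow> real p ^ n) (at_left (real p))"
      by (intro tendsto_intros)
    then show ?thesis by (rule order_tendstoD) simp
  qed
  then have "\<forall>\<^sub>F c in at_left (real p). \<forall>n\<in>{..<N}. c ^ n > real p ^ n - 1"
    by (intro eventually_ball_finite) auto
  moreover have "\<forall>\<^sub>F c in at_left (real p). c \<in> {max 1 g'<..<real p}"
    using p1 g' by (intro eventually_at_left_real) auto
  ultimately have "\<forall>\<^sub>F c in at_left (real p). (\<forall>n\<in>{..<N}. c ^ n > real p ^ n - 1) \<and> c \<in> {max 1 g'<..<real p}"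
    by (rule eventually_conj)
  then obtain c where small: "\<And>n. n < N \<Longrightarrow> c ^ n > real p ^ n - 1" and c: "c > 1" "c > g'" "c < real p"
    using eventually_happens'[OF trivial_limit_at_left_real] by fastforce
  show ?thesis
  proof (rule that[OF c(1,3)])
    fix n T assume n: "n \<ge> 1" and T: "T \<subseteq> ({..<n} \<rightarrow>\<^sub>E {0..<int p})" "AP3_free p n T"
    show "real (card T) \<le> c ^ n"
    proof (cases "n < N")
      case True
      have "real (card T) + 1 \<le> real p ^ n"
        using AP3_free_card_less[OF p n T] by (metis Suc_eq_plus1 Suc_leI of_nat_1 of_nat_add of_nat_le_iff of_nat_power)
      then show ?thesis using small[OF True] by simp
    next
      case False
      have "finite T" using T(1) by (rule finite_subset) (auto intro: finite_PiE)
      then have "real (card T) \<le> 3 * real (card (low_exponents p n))"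
        using AP3_free_card_le_low_exponents[OF p(1) _ T(2)] by linarith
      also have "\<dots> \<le> 3 * g ^ n"
        using card_low_exponents_le[OF t(1,2), of p n] by (simp add: g_def)
      also have "\<dots> \<le> g' ^ n" using big False by simp
      also have "\<dots> \<le> c ^ n" using g g' c by (intro power_mono) auto
      finally show ?thesis .
    qed
  qed
qed

section \<open>Zero-sum subsequences of integer vectors\<close>

lemma subset_image_msetE:
  assumes "R \<subseteq># image_mset f A"
  obtains B where "B \<subseteq># A" "R = image_mset f B"
proof -
  from assms obtain C where "image_mset f A = R + C"
    by (metis mset_subset_eq_exists_conv)
  then show ?thesis
    using that image_mset_eq_plusD by (metis mset_subset_eq_add_left)
qed

lemma exists_submset_size:
  assumes "k \<le> size M"
  obtains N where "N \<subseteq># M" "size N = k"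
proof -
  obtain xs where xs: "mset xs = M" using ex_mset by blast
  have "mset (take k xs) \<subseteq># M"
    by (metis append_take_drop_id mset_append mset_subset_eq_add_left xs)
  then show ?thesis using that[of "mset (take k xs)"] assms xs by auto
qed

lemma sum_mset_Union_mset:
  fixes f :: "'a \<Rightarrow> 'b :: comm_monoid_add"
  shows "(\<Sum>x\<in>#\<Sum>\<^sub># R. f x) = (\<Sum>T\<in>#R. \<Sum>x\<in>#T. f x)"
  by (induction R) auto

lemma size_Union_mset: "size (\<Sum>\<^sub># R) = (\<Sum>T\<in>#R. size T)" for R :: "'a multiset multiset"
  by (induction R) auto

lemma sum_mset_eq_sum_count:
  fixes f :: "'a \<Rightarrow> int"
  shows "(\<Sum>x\<in>#M. f x) = (\<Sum>x\<in>set_mset M. int (count M x) * f x)"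
proof -
  \<comment> \<open>A fixed index set \<open>A\<close> stays unchanged when a term is added to
    \<open>M\<close>.\<close>
  have "(\<Sum>x\<in>#M. f x) = (\<Sum>x\<in>A. int (count M x) * f x)" if "finite A" "set_mset M \<subseteq> A" for A
    using that(2)
  proof (induction M)
    case (add y M)
    have "(\<Sum>x\<in>A. int (count (add_mset y M) x) * f x) = (\<Sum>x\<in>A. int (count M x) * f x + (if x = y then f x else 0))"
      by (intro sum.cong) (auto simp: algebra_simps)
    with add that(1) show ?case by (simp add: sum.distrib)
  qed simp
  then show ?thesis by simp
qed

section \<open>Zero-sum bounds and their multiplicativity\<close>

text \<open>For positive \<open>q\<close> and \<open>n\<close> this encodes
  \<open>s((Z_q)^n) \<le> l\<close>. Unreduced integer vectors allow a block sum divisible by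
  \<open>b\<close> to be divided by \<open>b\<close> and used again as a term.\<close>

definition zero_sum_bound :: "nat \<Rightarrow> nat \<Rightarrow> nat \<Rightarrow> bool" where
  "zero_sum_bound q n l \<longleftrightarrow> (\<forall>S :: (nat \<Rightarrow> int) multiset. l \<le> size S \<longrightarrow>
     (\<exists>T. T \<subseteq># S \<and> size T = q \<and> (\<forall>i<n. int q dvd (\<Sum>x\<in>#T. x i))))"

definition reduce_vec :: "nat \<Rightarrow> nat \<Rightarrow> (nat \<Rightarrow> int) \<Rightarrow> nat \<Rightarrow> int" where
  "reduce_vec q n x = (\<lambda>i\<in>{..<n}. x i mod int q)"

lemma reduce_vec_in: "q > 0 \<Longrightarrow> reduce_vec q n x \<in> ({..<n} \<rightarrow>\<^sub>E {0..<int q})"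
  by (auto simp: reduce_vec_def)

lemma dvd_sum_reduce_vec:
  assumes "i < n"
  shows "int q dvd (\<Sum>x\<in>#image_mset (reduce_vec q n) T. x i) \<longleftrightarrow> int q dvd (\<Sum>x\<in>#T. x i)"
proof -
  have "(\<Sum>x\<in>#image_mset (reduce_vec q n) T. x i) mod int q = (\<Sum>x\<in>#T. x i) mod int q"
  proof (induction T)
    case (add x T)
    from mod_add_cong[OF mod_mod_trivial[of "x i" "int q"] add.IH] show ?case
      using assms by (simp add: reduce_vec_def)
  qed simp
  then show ?thesis by (simp add: dvd_eq_mod_eq_0)
qed

text \<open>Blocks are removed greedily while more than \<open>l\<close> terms remain. For positive
  \<open>j\<close> the size condition says \<open>(j - 1) * b + l < size S\<close>, because the last
  block needs only \<open>Suc l\<close> remaining terms.\<close>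

lemma zero_sum_bound_disjoint_blocks:
  assumes "zero_sum_bound b n (Suc l)" "j * b + l < size S + b"
  shows "\<exists>TT. size TT = j \<and> \<Sum>\<^sub># TT \<subseteq># S \<and>
           (\<forall>T\<in>#TT. size T = b \<and> (\<forall>i<n. int b dvd (\<Sum>x\<in>#T. x i)))"
  using assms(2)
proof (induction j arbitrary: S)
  case (Suc j)
  then have "Suc l \<le> size S" by simp
  then obtain T where T: "T \<subseteq># S" "size T = b" "\<forall>i<n. int b dvd (\<Sum>x\<in>#T. x i)"
    using assms(1) unfolding zero_sum_bound_def by blast
  then have "size (S - T) + b = size S"
    by (metis size_Diff_submset size_mset_mono le_add_diff_inverse2)
  then have "j * b + l < size (S - T) + b" using Suc.prems by simp
  then obtain TT where TT: "size TT = j" "\<Sum>\<^sub># TT \<subseteq># S - T"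
    "\<forall>T\<in>#TT. size T = b \<and> (\<forall>i<n. int b dvd (\<Sum>x\<in>#T. x i))"
    using Suc.IH by blast
  have "\<Sum>\<^sub># (add_mset T TT) \<subseteq># S"
    using TT(2) T(1) by (metis add_mset_add_single mset_subset_eq_mono_add_left_cancel
        subset_mset.add_diff_inverse sum_mset.add_mset)
  then show ?case using TT T by (intro exI[of _ "add_mset T TT"]) auto
qed (auto intro: exI[of _ "{#}"])

text \<open>Take \<open>Suc la\<close> disjoint blocks of length \<open>b\<close> with sums
  divisible by \<open>b\<close>, and apply the bound for \<open>a\<close> to the sums divided by
  \<open>b\<close>. The \<open>a\<close> selected blocks unite to the required subsequence.\<close>

lemma zero_sum_bound_mult:
  assumes b: "b > 0" and A: "zero_sum_bound a n (Suc la)" and B: "zero_sum_bound b n (Suc lb)"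
  shows "zero_sum_bound (a * b) n (Suc (la * b + lb))"
  unfolding zero_sum_bound_def
proof (intro allI impI)
  fix S :: "(nat \<Rightarrow> int) multiset"
  assume "Suc (la * b + lb) \<le> size S"
  then have "Suc la * b + lb < size S + b" by simp
  then obtain TT where TT: "size TT = Suc la" "\<Sum>\<^sub># TT \<subseteq># S"
    "\<forall>T\<in>#TT. size T = b \<and> (\<forall>i<n. int b dvd (\<Sum>x\<in>#T. x i))"
    using zero_sum_bound_disjoint_blocks[OF B] by blast
  define q where "q T = (\<lambda>i. (\<Sum>x\<in>#T. x i) div int b)" for T :: "(nat \<Rightarrow> int) multiset"
  obtain R where R: "R \<subseteq># image_mset q TT" "size R = a" "\<forall>i<n. int a dvd (\<Sum>x\<in>#R. x i)"
    using A[unfolded zero_sum_bound_def, rule_format, of "image_mset q TT"] TT(1) by auto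
  obtain R' where R': "R' \<subseteq># TT" "R = image_mset q R'"
    using R(1) by (rule subset_image_msetE)
  have blocks: "size T = b" "\<And>i. i < n \<Longrightarrow> (\<Sum>x\<in>#T. x i) = int b * q T i" if "T \<in># R'" for T
    using TT(3) mset_subset_eqD[OF R'(1) that] by (auto simp: q_def)
  show "\<exists>T. T \<subseteq># S \<and> size T = a * b \<and> (\<forall>i<n. int (a * b) dvd (\<Sum>x\<in>#T. x i))"
  proof (intro exI conjI allI impI)
    obtain C where "TT = R' + C" using R'(1) by (metis mset_subset_eq_exists_conv)
    then show "\<Sum>\<^sub># R' \<subseteq># S"
      using TT(2) by (metis mset_subset_eq_add_left subset_mset.order_trans sum_mset.union)
    have "(\<Sum>T\<in>#R'. size T) = (\<Sum>T\<in>#R'. b)"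
      using blocks(1) by (intro arg_cong[of _ _ sum_mset] image_mset_cong) auto
    then show "size (\<Sum>\<^sub># R') = a * b"
      using R(2) R'(2) by (simp add: size_Union_mset)
    fix i assume i: "i < n"
    have "(\<Sum>T\<in>#R'. \<Sum>x\<in>#T. x i) = (\<Sum>T\<in>#R'. int b * q T i)"
      using blocks(2)[OF _ i] by (intro arg_cong[of _ _ sum_mset] image_mset_cong) auto
    also have "\<dots> = int b * (\<Sum>x\<in>#R. x i)"
      by (simp add: R'(2) sum_mset_distrib_left image_mset.compositionality comp_def)
    finally show "int (a * b) dvd (\<Sum>x\<in>#\<Sum>\<^sub># R'. x i)"
      using R(3) i by (simp add: sum_mset_Union_mset mult.commute)
  qed
qed

text \<open>Some residue vector occurs \<open>q\<close> times, and \<open>q\<close> congruent terms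
  sum to zero. Besides the case \<open>q = 2\<close>, this shows that \<open>egz\<close> is a
  minimum over a nonempty set.\<close>

lemma zero_sum_bound_pigeonhole:
  assumes "q > 0"
  shows "zero_sum_bound q n (Suc (q ^ n * (q - 1)))"
  unfolding zero_sum_bound_def
proof (intro allI impI)
  fix S :: "(nat \<Rightarrow> int) multiset"
  assume S: "Suc (q ^ n * (q - 1)) \<le> size S"
  define M where "M = image_mset (reduce_vec q n) S"
  have sub: "set_mset M \<subseteq> ({..<n} \<rightarrow>\<^sub>E {0..<int q})"
    using assms reduce_vec_in by (auto simp: M_def)
  have "\<exists>y. q \<le> count M y"
  proof (rule ccontr)
    assume *: "\<nexists>y. q \<le> count M y"
    have "count M y \<le> q - 1" for y
      using * by (metis Suc_diff_1 assms less_Suc_eq_le not_le)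
    then have "size M \<le> card (set_mset M) * (q - 1)"
      unfolding size_multiset_overloaded_eq using sum_bounded_above[of "set_mset M" "count M" "q - 1"] by simp
    also have "\<dots> \<le> card ({..<n} \<rightarrow>\<^sub>E {0..<int q}) * (q - 1)"
      using sub by (intro mult_right_mono card_mono finite_PiE) auto
    also have "\<dots> = q ^ n * (q - 1)" by (simp add: card_PiE)
    finally show False using S by (simp add: M_def)
  qed
  then obtain y where "replicate_mset q y \<subseteq># M"
    by (auto simp: count_le_replicate_mset_subset_eq)
  then obtain T where T: "T \<subseteq># S" "replicate_mset q y = image_mset (reduce_vec q n) T"
    unfolding M_def by (rule subset_image_msetE)
  have "size T = q" using arg_cong[OF T(2), of size] by simp
  moreover have "int q dvd (\<Sum>x\<in>#T. x i)" if "i < n" for i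
    using dvd_sum_reduce_vec[OF that, of q T] by (simp flip: T(2))
  ultimately show "\<exists>T. T \<subseteq># S \<and> size T = q \<and> (\<forall>i<n. int q dvd (\<Sum>x\<in>#T. x i))"
    using T(1) by blast
qed

text \<open>The constant survives each step, since
  \<open>C * (p - 1) * k + C * (k - 1) = C * (p * k - 1)\<close>.\<close>

lemma zero_sum_bound_prime_divisors:
  fixes C :: real
  assumes "k > 0" and C: "C \<ge> 0"
    and "\<And>p. prime p \<Longrightarrow> p dvd k \<Longrightarrow> \<exists>l. zero_sum_bound p n (Suc l) \<and> real l \<le> C * (real p - 1)"
  shows "\<exists>l. zero_sum_bound k n (Suc l) \<and> real l \<le> C * (real k - 1)"
  using assms(1,3)
proof (induction k rule: prime_divisors_induct)
  case (unit k)
  then show ?case using zero_sum_bound_pigeonhole[of 1 n] by (intro exI[of _ 0]) auto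
next
  case (factor p k)
  then obtain la lb where l: "zero_sum_bound p n (Suc la)" "real la \<le> C * (real p - 1)"
    "zero_sum_bound k n (Suc lb)" "real lb \<le> C * (real k - 1)"
    by (metis dvd_mult dvd_triv_left nat_0_less_mult_iff)
  have "zero_sum_bound (p * k) n (Suc (la * k + lb))"
    using factor.prems by (intro zero_sum_bound_mult l) simp
  moreover have "real (la * k + lb) \<le> C * (real p - 1) * real k + C * (real k - 1)"
    using l(2,4) by (simp add: add_mono mult_right_mono)
  ultimately show ?case by (intro exI[of _ "la * k + lb"]) (simp add: algebra_simps)
qed simp

section \<open>The groups \<open>(Z_q)\<^sup>n\<close>\<close>

lemma comm_group_Zmod_pow: "comm_group (Zmod_pow q n)"
  unfolding Zmod_pow_def
  by (rule group.group_comm_groupI) (auto simp: add.commute)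

lemma carrier_Zmod_pow: "q > 0 \<Longrightarrow> carrier (Zmod_pow q n) = ({..<n} \<rightarrow>\<^sub>E {0..<int q})"
  by (simp add: Zmod_pow_def carrier_integer_mod_group)

lemma pow_Zmod_pow: "x [^]\<^bsub>Zmod_pow q n\<^esub> k = (\<lambda>i\<in>{..<n}. int k * x i mod int q)" for k :: nat
proof (induction k)
  case 0
  show ?case by (auto simp: Zmod_pow_def)
next
  case (Suc k)
  then show ?case
    by (auto simp: Zmod_pow_def fun_eq_iff mod_add_right_eq algebra_simps)
qed

lemma finprod_Zmod_pow:
  assumes "finite A" "A \<subseteq> carrier (Zmod_pow q n)"
  shows "finprod (Zmod_pow q n) (\<lambda>x. x [^]\<^bsub>Zmod_pow q n\<^esub> f x) A =
           (\<lambda>i\<in>{..<n}. (\<Sum>x\<in>A. int (f x) * x i) mod int q)" (is "finprod ?G _ _ = _")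
proof -
  interpret comm_group ?G by (rule comm_group_Zmod_pow)
  show ?thesis
    using assms
  proof (induction A rule: finite_induct)
    case empty
    have "\<one>\<^bsub>?G\<^esub> = (\<lambda>i\<in>{..<n}. 0)" by (simp add: Zmod_pow_def)
    then show ?case by simp
  next
    case (insert x A)
    have "finprod ?G (\<lambda>x. x [^]\<^bsub>?G\<^esub> f x) (insert x A) =
        x [^]\<^bsub>?G\<^esub> f x \<otimes>\<^bsub>?G\<^esub> finprod ?G (\<lambda>x. x [^]\<^bsub>?G\<^esub> f x) A"
      using insert by (intro finprod_insert) auto
    also have "\<dots> = (\<lambda>i\<in>{..<n}. (\<Sum>x\<in>insert x A. int (f x) * x i) mod int q)"
      using insert by (auto simp: pow_Zmod_pow) (auto simp: Zmod_pow_def mod_add_eq restrict_def)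
    finally show ?case .
  qed
qed

lemma seq_sum_Zmod_pow_eq_one_iff:
  assumes "S \<in> sequences_over (Zmod_pow q n)"
  shows "seq_sum (Zmod_pow q n) S = \<one>\<^bsub>Zmod_pow q n\<^esub> \<longleftrightarrow> (\<forall>i<n. int q dvd (\<Sum>x\<in>#S. x i))"
proof -
  have "seq_sum (Zmod_pow q n) S = (\<lambda>i\<in>{..<n}. (\<Sum>x\<in>#S. x i) mod int q)"
    using assms finprod_Zmod_pow[of "set_mset S" q n "count S"]
    by (simp add: seq_sum_def sequences_over_def sum_mset_eq_sum_count)
  then show ?thesis
    by (auto simp: Zmod_pow_def dvd_eq_mod_eq_0 restrict_def fun_eq_iff)
qed

lemma has_zero_sum_subseq_Zmod_pow_iff:
  assumes "S \<in> sequences_over (Zmod_pow q n)"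
  shows "has_zero_sum_subseq (Zmod_pow q n) l S \<longleftrightarrow>
           (\<exists>T. T \<subseteq># S \<and> size T = l \<and> (\<forall>i<n. int q dvd (\<Sum>x\<in>#T. x i)))"
proof -
  have "T \<in> sequences_over (Zmod_pow q n)" if "T \<subseteq># S" for T
    using assms set_mset_mono[OF that] by (auto simp: sequences_over_def)
  then show ?thesis
    using seq_sum_Zmod_pow_eq_one_iff by (auto simp: has_zero_sum_subseq_def)
qed

lemma group_exp_Zmod_pow:
  assumes "q > 0" "n \<ge> 1"
  shows "group_exp (Zmod_pow q n) = q"
  unfolding group_exp_def
proof (rule Least_equality)
  show "q > 0 \<and> (\<forall>x\<in>carrier (Zmod_pow q n). x [^]\<^bsub>Zmod_pow q n\<^esub> q = \<one>\<^bsub>Zmod_pow q n\<^esub>)"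
    using assms by (auto simp: pow_Zmod_pow) (auto simp: Zmod_pow_def)
next
  fix e :: nat assume e: "e > 0 \<and> (\<forall>x\<in>carrier (Zmod_pow q n). x [^]\<^bsub>Zmod_pow q n\<^esub> e = \<one>\<^bsub>Zmod_pow q n\<^esub>)"
  \<comment> \<open>The all-ones vector has order \<open>q\<close>; reduction keeps it in the
    carrier even for \<open>q = 1\<close>.\<close>
  define x where "x = reduce_vec q n (\<lambda>_. 1)"
  have "x [^]\<^bsub>Zmod_pow q n\<^esub> e = \<one>\<^bsub>Zmod_pow q n\<^esub>"
    using e assms reduce_vec_in by (auto simp: x_def carrier_Zmod_pow)
  from fun_cong[OF this, of 0] have "int e * (1 mod int q) mod int q = 0"
    using assms by (simp add: x_def pow_Zmod_pow reduce_vec_def) (simp add: Zmod_pow_def)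
  then have "int q dvd int e" by (simp add: mod_mult_right_eq dvd_eq_mod_eq_0)
  then show "q \<le> e" using e by (simp add: dvd_imp_le)
qed

text \<open>Divisibility of sums depends only on residues, so a zero-sum subsequence of the reduced
  sequence lifts to the original integer vectors.\<close>

lemma zero_sum_bound_iff_Zmod_pow:
  assumes q: "q > 0" "n \<ge> 1"
  shows "zero_sum_bound q n l \<longleftrightarrow> (\<forall>S\<in>sequences_over (Zmod_pow q n). l \<le> size S \<longrightarrow>
           has_zero_sum_subseq (Zmod_pow q n) (group_exp (Zmod_pow q n)) S)" (is "_ \<longleftrightarrow> ?R")
proof
  assume "zero_sum_bound q n l"
  then show ?R
    using q by (auto simp: zero_sum_bound_def has_zero_sum_subseq_Zmod_pow_iff group_exp_Zmod_pow)
next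
  assume R: ?R
  show "zero_sum_bound q n l"
    unfolding zero_sum_bound_def
  proof (intro allI impI)
    fix S :: "(nat \<Rightarrow> int) multiset" assume S: "l \<le> size S"
    let ?S = "image_mset (reduce_vec q n) S"
    have seq: "?S \<in> sequences_over (Zmod_pow q n)"
      using q(1) reduce_vec_in by (auto simp: sequences_over_def carrier_Zmod_pow)
    then have "has_zero_sum_subseq (Zmod_pow q n) q ?S"
      using R S q by (simp add: group_exp_Zmod_pow)
    then obtain T' where T': "T' \<subseteq># ?S" "size T' = q" "\<forall>i<n. int q dvd (\<Sum>x\<in>#T'. x i)"
      using has_zero_sum_subseq_Zmod_pow_iff[OF seq] by auto
    obtain T where "T \<subseteq># S" "T' = image_mset (reduce_vec q n) T"
      using T'(1) by (rule subset_image_msetE)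
    then show "\<exists>T. T \<subseteq># S \<and> size T = q \<and> (\<forall>i<n. int q dvd (\<Sum>x\<in>#T. x i))"
      using T'(2,3) dvd_sum_reduce_vec by (metis size_image_mset)
  qed
qed

section \<open>Extremal sequences and Property D\<close>

lemma egz_Zmod_pow_eq_Least:
  assumes "q > 0" "n \<ge> 1"
  shows "egz (Zmod_pow q n) = (LEAST l. zero_sum_bound q n l)"
  unfolding egz_def zero_sum_bound_iff_Zmod_pow[OF assms] ..

lemma zero_sum_bound_egz:
  assumes "q > 0" "n \<ge> 1"
  shows "zero_sum_bound q n (egz (Zmod_pow q n))"
  unfolding egz_Zmod_pow_eq_Least[OF assms] using zero_sum_bound_pigeonhole[OF assms(1)] by (rule LeastI)

text \<open>Minimality of \<open>egz\<close> yields a sequence of length at least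
  \<open>egz - 1\<close> without the zero-sum subsequence; trimming it gives the exact length that
  Property D asks for.\<close>

lemma extremal_sequence_Zmod_pow:
  assumes q: "q > 0" "n \<ge> 1"
  obtains S where "S \<in> sequences_over (Zmod_pow q n)" "Suc (size S) = egz (Zmod_pow q n)"
    "\<not> has_zero_sum_subseq (Zmod_pow q n) q S"
proof -
  let ?G = "Zmod_pow q n"
  \<comment> \<open>The empty sequence has no subsequence of length \<open>q > 0\<close>; this makes
    the natural subtraction \<open>egz ?G - 1\<close> genuine.\<close>
  have "egz ?G \<noteq> 0"
  proof
    assume "egz ?G = 0"
    then have "zero_sum_bound q n 0" using zero_sum_bound_egz[OF q] by simp
    then show False
      using q(1) unfolding zero_sum_bound_def by (metis empty_le less_irrefl size_empty subset_mset.le_zero_eq zero_le)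
  qed
  then have "\<not> zero_sum_bound q n (egz ?G - 1)"
    using not_less_Least[of "egz ?G - 1" "zero_sum_bound q n"] egz_Zmod_pow_eq_Least[OF q] by simp
  then obtain S0 where S0: "S0 \<in> sequences_over ?G" "egz ?G - 1 \<le> size S0" "\<not> has_zero_sum_subseq ?G q S0"
    using zero_sum_bound_iff_Zmod_pow[OF q] group_exp_Zmod_pow[OF q] by auto
  obtain S where S: "S \<subseteq># S0" "size S = egz ?G - 1"
    using S0(2) by (rule exists_submset_size)
  show ?thesis
  proof (rule that)
    show "S \<in> sequences_over ?G"
      using S0(1) set_mset_mono[OF S(1)] by (auto simp: sequences_over_def)
    show "Suc (size S) = egz ?G" using S(2) \<open>egz ?G \<noteq> 0\<close> by simp
    show "\<not> has_zero_sum_subseq ?G q S"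
      using S0(3) S(1) subset_mset.order_trans by (auto simp: has_zero_sum_subseq_def)
  qed
qed

text \<open>
  A nontrivial solution of \<open>x + y = 2 z\<close> in \<open>T\<close> would give the zero-sum sequence
  \<open>x, y, z, \<dots>, z\<close> with \<open>p - 2\<close> copies of \<open>z\<close>.
\<close>

lemma egz_property_D:
  assumes p: "prime p" "odd p" and n: "n \<ge> 1" and D: "property_D p n"
  obtains T where "T \<subseteq> ({..<n} \<rightarrow>\<^sub>E {0..<int p})" "AP3_free p n T"
    "egz (Zmod_pow p n) = Suc (card T * (p - 1))"
proof -
  let ?G = "Zmod_pow p n"
  have p3: "p \<ge> 3" using p prime_ge_2_nat[of p] by (cases "p = 2") auto
  then have p0: "p > 0" by simp
  obtain S where S: "S \<in> sequences_over ?G" "Suc (size S) = egz ?G" "\<not> has_zero_sum_subseq ?G p S"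
    using extremal_sequence_Zmod_pow[OF p0 n] by blast
  then obtain T where T: "T \<in> sequences_over ?G" "S = repeat_mset (p - 1) T"
    using D unfolding property_D_def by (metis diff_Suc_1)
  have none: False if "R \<subseteq># S" "size R = p" "\<And>i. i < n \<Longrightarrow> int p dvd (\<Sum>x\<in>#R. x i)" for R
    using S(3) that unfolding has_zero_sum_subseq_Zmod_pow_iff[OF S(1)] by blast
  have sub: "set_mset T \<subseteq> ({..<n} \<rightarrow>\<^sub>E {0..<int p})"
    using T(1) p0 by (auto simp: sequences_over_def carrier_Zmod_pow)
  \<comment> \<open>A repeated term of \<open>T\<close> would occur at least
    \<open>2 * (p - 1) \<ge> p\<close> times in \<open>S\<close>, and \<open>p\<close> copies of it
    sum to zero.\<close>
  have count1: "count T x = 1" if x: "x \<in># T" for x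
  proof (rule ccontr)
    assume "count T x \<noteq> 1"
    then have "2 \<le> count T x" using x count_greater_zero_iff[of T x] by linarith
    then have "(p - 1) * 2 \<le> count S x" unfolding T(2) by simp
    then have "p \<le> count S x" using p3 by linarith
    then have "replicate_mset p x \<subseteq># S" by (simp add: count_le_replicate_mset_subset_eq)
    then show False by (rule none) auto
  qed
  have countS: "count S x = p - 1" if "x \<in># T" for x
    using count1[OF that] by (simp add: T(2))
  have size: "size S = card (set_mset T) * (p - 1)"
  proof -
    have "size S = (p - 1) * size T" unfolding T(2) by (induction "p - 1") auto
    moreover have "size T = card (set_mset T)"
      unfolding size_multiset_overloaded_eq using count1 by simp
    ultimately show ?thesis by simp
  qed
  \<comment> \<open>The factor 2 is invertible modulo the odd \<open>p\<close>, and congruent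
    reduced residues coincide.\<close>
  have eqI: "x = y" if "x \<in># T" "y \<in># T" "\<And>i. i < n \<Longrightarrow> int p dvd 2 * (x i - y i)" for x y
  proof (rule PiE_ext)
    show "x \<in> ({..<n} \<rightarrow>\<^sub>E {0..<int p})" "y \<in> ({..<n} \<rightarrow>\<^sub>E {0..<int p})" using that sub by auto
    fix i assume i: "i \<in> {..<n}"
    have "coprime (int p) 2" using p(2) by simp
    then have "int p dvd x i - y i" using that(3) i coprime_dvd_mult_right_iff by blast
    moreover have "x i \<in> {0..<int p}" "y i \<in> {0..<int p}"
      using that(1,2) sub i by (meson PiE_mem subsetD)+
    ultimately show "x i = y i" using dvd_imp_le_int[of "x i - y i" "int p"] by (cases "x i = y i") auto
  qed
  have "AP3_free p n (set_mset T)"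
    unfolding AP3_free_def
  proof (intro ballI impI)
    fix x y z assume xyz: "x \<in># T" "y \<in># T" "z \<in># T" and ap: "\<forall>i<n. int p dvd x i + y i - 2 * z i"
    \<comment> \<open>A progression with two equal members is constant. In the remaining case
      \<open>x\<close>, \<open>y\<close>, \<open>z\<close> are distinct and each occurs at most
      \<open>p - 1\<close> times in \<open>R\<close>, as often as \<open>S\<close> allows.\<close>
    have xz: "x = z" if "x = y" using xyz ap that by (intro eqI) (auto simp: algebra_simps)
    have zx: "x = y" if "z = x"
    proof (rule eqI[OF xyz(1,2)])
      fix i assume "i < n"
      then have "int p dvd y i - x i" using ap that by (auto simp: algebra_simps)
      then show "int p dvd 2 * (x i - y i)" using dvd_diff_commute dvd_mult by blast
    qed
    have zy: "x = y" if "z = y"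
    proof (rule eqI[OF xyz(1,2)])
      fix i assume "i < n"
      then have "int p dvd x i - y i" using ap that by (auto simp: algebra_simps)
      then show "int p dvd 2 * (x i - y i)" using dvd_mult by blast
    qed
    have "x = y"
    proof (rule ccontr)
      assume "x \<noteq> y"
      then have ne: "z \<noteq> x" "z \<noteq> y" using zx zy by auto
      define R where "R = {#x, y#} + replicate_mset (p - 2) z"
      show False
      proof (rule none)
        show "R \<subseteq># S"
        proof (rule mset_subset_eqI)
          show "count R a \<le> count S a" for a
            using countS[OF xyz(1)] countS[OF xyz(2)] countS[OF xyz(3)] \<open>x \<noteq> y\<close> ne p3
            by (cases "a = x"; cases "a = y"; cases "a = z") (simp_all add: R_def)
        qed
        show "size R = p" using p3 by (simp add: R_def)
        fix i assume "i < n"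
        have "(\<Sum>x\<in>#R. x i) = (x i + y i - 2 * z i) + int p * z i"
          using p3 by (simp add: R_def of_nat_diff algebra_simps)
        then show "int p dvd (\<Sum>x\<in>#R. x i)" using ap \<open>i < n\<close> by simp
      qed
    qed
    then show "x = y \<and> y = z" using xz by simp
  qed
  then show ?thesis using that[OF sub] size S(2) by simp
qed

section \<open>The bound for \<open>(Z_mk)^n\<close>\<close>

theorem theorem1p13:
  shows "\<exists>c :: nat \<Rightarrow> real. \<forall>(P :: nat set) (k :: nat).
    finite P \<and> P \<noteq> {} \<and> (\<forall>p\<in>P. prime p \<and> odd p) \<and>
    k > 1 \<and> (\<exists>e :: nat \<Rightarrow> nat. k = (\<Prod>p\<in>P. p ^ e p)) \<and>
    (\<forall>p\<in>P. \<forall>n\<ge>1. property_D p n) \<longrightarrow>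
      1 < c k \<and> c k < real k \<and>
      (\<forall>(m :: nat) (n :: nat). (\<exists>a :: nat. m = 2 ^ a) \<and> n \<ge> 1 \<longrightarrow>
        real (egz (Zmod_pow (m * k) n))
          \<le> 2 ^ n * (real m - 1) * real k + c k ^ n * (real k - 1) + 1)"
proof -
  have "\<forall>p. \<exists>c :: real. prime p \<and> odd p \<longrightarrow> 1 < c \<and> c < real p \<and>
      (\<forall>n T. n \<ge> 1 \<and> T \<subseteq> ({..<n} \<rightarrow>\<^sub>E {0..<int p}) \<and> AP3_free p n T \<longrightarrow> real (card T) \<le> c ^ n)"
    using AP3_free_exponential_bound by metis
  then obtain c0 :: "nat \<Rightarrow> real" where c0: "\<And>p. prime p \<Longrightarrow> odd p \<Longrightarrow> 1 < c0 p \<and> c0 p < real p \<and>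
      (\<forall>n T. n \<ge> 1 \<and> T \<subseteq> ({..<n} \<rightarrow>\<^sub>E {0..<int p}) \<and> AP3_free p n T \<longrightarrow> real (card T) \<le> c0 p ^ n)"
    by metis
  \<comment> \<open>The maximum runs over the prime divisors of \<open>k\<close> rather than over
    \<open>P\<close>, so \<open>c\<close> is fixed before \<open>P\<close> is chosen.\<close>
  define c where "c k = Max (c0 ` prime_factors k)" for k
  show ?thesis
  proof (intro exI[of _ c] allI impI, elim conjE exE)
    fix P :: "nat set" and k :: nat and e :: "nat \<Rightarrow> nat"
    assume P: "finite P" "\<forall>p\<in>P. prime p \<and> odd p" and k: "k > 1" "k = (\<Prod>p\<in>P. p ^ e p)"
      and D: "\<forall>p\<in>P. \<forall>n\<ge>1. property_D p n"
    have inP: "p \<in> P" if "prime p" "p dvd k" for p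
    proof -
      have "\<exists>q\<in>P. p dvd q ^ e q"
        using that(2) unfolding k(2) prime_dvd_prod_iff[OF P(1) that(1)] .
      then obtain q where "q \<in> P" "p dvd q ^ e q" by blast
      moreover from this have "p dvd q" using that(1) prime_dvd_power by blast
      ultimately show ?thesis using P(2) that(1) primes_dvd_imp_eq by blast
    qed
    have le: "c0 p \<le> c k" if "prime p" "p dvd k" for p
      unfolding c_def using that k(1) by (intro Max_ge) (auto simp: in_prime_factors_iff)
    have "prime_factors k \<noteq> {}" using k(1) by (simp add: prime_factorization_empty_iff)
    \<comment> \<open>The maximum is attained at some prime \<open>p\<close> dividing
      \<open>k\<close>, whence \<open>c k < p \<le> k\<close>.\<close>
    then have "c k \<in> c0 ` prime_factors k" unfolding c_def by (intro Max_in) auto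
    then obtain p where p: "prime p" "p dvd k" "c k = c0 p" by (auto simp: in_prime_factors_iff)
    have "1 < c0 p" "c0 p < real p" using c0 P(2) inP p by blast+
    moreover have "p \<le> k" using p k(1) by (intro dvd_imp_le) auto
    ultimately have c: "1 < c k" "c k < real k" using p(3) by auto
    have "real (egz (Zmod_pow (m * k) n)) \<le> 2 ^ n * (real m - 1) * real k + c k ^ n * (real k - 1) + 1"
      if m: "m = 2 ^ a" and n: "n \<ge> 1" for m n a :: nat
    proof -
      have "\<exists>l. zero_sum_bound k n (Suc l) \<and> real l \<le> c k ^ n * (real k - 1)"
      proof (rule zero_sum_bound_prime_divisors)
        fix p assume p: "prime p" "p dvd k"
        then have pP: "odd p" "property_D p n" using inP P(2) D n by auto
        obtain T where T: "T \<subseteq> ({..<n} \<rightarrow>\<^sub>E {0..<int p})" "AP3_free p n T"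
          "egz (Zmod_pow p n) = Suc (card T * (p - 1))"
          using egz_property_D[OF p(1) pP(1) n pP(2)] by blast
        have p1: "p > 1" using p(1) prime_gt_1_nat by blast
        have "real (card T) \<le> c0 p ^ n" using c0[OF p(1) pP(1)] n T by blast
        also have "\<dots> \<le> c k ^ n" using le[OF p] c0[OF p(1) pP(1)] by (intro power_mono) auto
        finally have "real (card T * (p - 1)) \<le> c k ^ n * (real p - 1)"
          using p1 by (simp add: of_nat_diff mult_right_mono)
        moreover have "zero_sum_bound p n (Suc (card T * (p - 1)))"
          using zero_sum_bound_egz[of p n] p1 n T(3) by simp
        ultimately show "\<exists>l. zero_sum_bound p n (Suc l) \<and> real l \<le> c k ^ n * (real p - 1)" by blast
      qed (use k(1) c(1) in auto)
      then obtain lk where lk: "zero_sum_bound k n (Suc lk)" "real lk \<le> c k ^ n * (real k - 1)" by blast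
      have "\<exists>l. zero_sum_bound m n (Suc l) \<and> real l \<le> 2 ^ n * (real m - 1)"
      proof (rule zero_sum_bound_prime_divisors)
        fix p assume "prime p" "p dvd m"
        then have "p = 2" using m by (metis prime_dvd_power primes_dvd_imp_eq two_is_prime_nat)
        then show "\<exists>l. zero_sum_bound p n (Suc l) \<and> real l \<le> 2 ^ n * (real p - 1)"
          using zero_sum_bound_pigeonhole[of 2 n] by (intro exI[of _ "2 ^ n"]) simp
      qed (use m in auto)
      then obtain lm where lm: "zero_sum_bound m n (Suc lm)" "real lm \<le> 2 ^ n * (real m - 1)" by blast
      \<comment> \<open>The order of the factors matters: blocks are formed modulo \<open>k\<close>
        first, so the factor \<open>k\<close> falls on the term with \<open>2 ^ n\<close>.\<close>
      have "zero_sum_bound (m * k) n (Suc (lm * k + lk))"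
        using k(1) lm(1) lk(1) by (intro zero_sum_bound_mult) auto
      then have "egz (Zmod_pow (m * k) n) \<le> Suc (lm * k + lk)"
        using k(1) m n by (subst egz_Zmod_pow_eq_Least) (auto intro: Least_le)
      then have "real (egz (Zmod_pow (m * k) n)) \<le> real lm * real k + real lk + 1"
        by (metis Suc_eq_plus1 of_nat_1 of_nat_add of_nat_le_iff of_nat_mult)
      moreover have "real lm * real k \<le> 2 ^ n * (real m - 1) * real k"
        using lm(2) by (intro mult_right_mono) auto
      ultimately show ?thesis using lk(2) by linarith
    qed
    with c show "1 < c k \<and> c k < real k \<and>
      (\<forall>(m :: nat) (n :: nat). (\<exists>a :: nat. m = 2 ^ a) \<and> n \<ge> 1 \<longrightarrow>
        real (egz (Zmod_pow (m * k) n))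
          \<le> 2 ^ n * (real m - 1) * real k + c k ^ n * (real k - 1) + 1)"
      by blast
  qed
qed

end
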